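(* Let $\Phi$ be the real affine root system of type $A_2^{(2)}$ and let $\Psi$ be a maximal closed subroot system of $\Phi$. Then one of the following holds: (1) $\mathrm{Gr}(\Psi)=\{\pm\epsilon_1,\pm2\epsilon_1\}$ and, for some $k\in\mathbb Z_{\ge0}$ and some odd prime number $q$, $$\Psi=\Psi(k,q):=\{\pm(\epsilon_1+(k+\tfrac12+rq)\delta),\ \pm(2\epsilon_1+(2k+1+(2r+1)q)\delta):r\in\mathbb Z\};$$ (2) $\mathrm{Gr}(\Psi)=\{\pm\epsilon_1\}$ and $\Psi=\{\pm(\epsilon_1+(2r+\tfrac12)\delta):r\in\mathbb Z\}$ or $\Psi=\{\pm(\epsilon_1+(2r+\tfrac32)\delta):r\in\mathbb Z\}$; (3) $\mathrm{Gr}(\Psi)=\{\pm2\epsilon_1\}$ and $\Psi=\{\pm(2\epsilon_1+2r\delta):r\in\mathbb Z\}$. If $\Psi=\Psi(k,q)$, then the type of $\Psi$ is $A_2^{(2)}$; otherwise it is $A_1^{(1)}$.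
   Context: $\epsilon_1$ is a unit vector and $\delta$ is a vector linearly independent of it with $(\delta,\cdot)=0$. $$\Phi=\{\pm\epsilon_1+(r+\tfrac12)\delta,\ \pm2\epsilon_1+2r\delta:r\in\mathbb Z\}.$$ With $\langle\beta,\alpha^\vee\rangle=2(\beta,\alpha)/(\alpha,\alpha)$ and $\mathbf s_\alpha(\beta)=\beta-\langle\beta,\alpha^\vee\rangle\alpha$, a non-empty subset $\Psi\subseteq\Phi$ is a subroot system if $\mathbf s_\alpha(\beta)\in\Psi$ for all $\alpha,\beta\in\Psi$; it is closed if $\alpha,\beta\in\Psi$, $\alpha+\beta\in\Phi$ imply $\alpha+\beta\in\Psi$. A maximal closed subroot system of $\Phi$ is a proper closed subroot system $\Psi$ such that $\Psi\subseteq\Delta\subsetneq\Phi$ with $\Delta$ a closed subroot system implies $\Delta=\Psi$. The gradient is $\mathrm{Gr}(\Psi)=\{\alpha\in\{\pm\epsilon_1,\pm2\epsilon_1\}:\alpha+r\delta\in\Psi\text{ for some }r\}$. Type: an irreducible subroot system $\Psi$ is of type $X_k^{(t)}$ if there is a linear isomorphism from the real span of $\Psi$ onto the real span of the real affine root system of type $X_k^{(t)}$ mapping $\Psi$ onto it and preserving the integers $\langle\beta,\alpha^\vee\rangle$. The real roots of type $A_1^{(1)}$ are $\{\pm\alpha+r\delta:r\in\mathbb Z\}$; those of type $A_2^{(2)}$ are $\Phi$ itself. *)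

theory Defs
  imports "HOL-Analysis.Analysis" "HOL-Computational_Algebra.Primes"
begin

definition pairing :: "('v::real_vector \<Rightarrow> 'v \<Rightarrow> real) \<Rightarrow> 'v \<Rightarrow> 'v \<Rightarrow> real" where
  "pairing form \<beta> \<alpha> = 2 * form \<beta> \<alpha> / form \<alpha> \<alpha>"

definition reflect :: "('v::real_vector \<Rightarrow> 'v \<Rightarrow> real) \<Rightarrow> 'v \<Rightarrow> 'v \<Rightarrow> 'v" where
  "reflect form \<alpha> \<beta> = \<beta> - pairing form \<beta> \<alpha> *\<^sub>R \<alpha>"

definition subroot_system ::
  "('v::real_vector \<Rightarrow> 'v \<Rightarrow> real) \<Rightarrow> 'v set \<Rightarrow> 'v set \<Rightarrow> bool" where
  "subroot_system form \<Phi> \<Psi> \<longleftrightarrow>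
     \<Psi> \<noteq> {} \<and> \<Psi> \<subseteq> \<Phi> \<and> (\<forall>\<alpha>\<in>\<Psi>. \<forall>\<beta>\<in>\<Psi>. reflect form \<alpha> \<beta> \<in> \<Psi>)"

definition closed_subroot_system ::
  "('v::real_vector \<Rightarrow> 'v \<Rightarrow> real) \<Rightarrow> 'v set \<Rightarrow> 'v set \<Rightarrow> bool" where
  "closed_subroot_system form \<Phi> \<Psi> \<longleftrightarrow>
     subroot_system form \<Phi> \<Psi> \<and>
     (\<forall>\<alpha>\<in>\<Psi>. \<forall>\<beta>\<in>\<Psi>. \<alpha> + \<beta> \<in> \<Phi> \<longrightarrow> \<alpha> + \<beta> \<in> \<Psi>)"

definition maximal_closed_subroot_system ::
  "('v::real_vector \<Rightarrow> 'v \<Rightarrow> real) \<Rightarrow> 'v set \<Rightarrow> 'v set \<Rightarrow> bool" where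
  "maximal_closed_subroot_system form \<Phi> \<Psi> \<longleftrightarrow>
     closed_subroot_system form \<Phi> \<Psi> \<and> \<Psi> \<noteq> \<Phi> \<and>
     (\<forall>\<Delta>. closed_subroot_system form \<Phi> \<Delta> \<and> \<Psi> \<subseteq> \<Delta> \<and> \<Delta> \<subset> \<Phi> \<longrightarrow> \<Delta> = \<Psi>)"

definition irreducible_roots :: "('v::real_vector \<Rightarrow> 'v \<Rightarrow> real) \<Rightarrow> 'v set \<Rightarrow> bool" where
  "irreducible_roots form \<Psi> \<longleftrightarrow>
     \<Psi> \<noteq> {} \<and>
     \<not> (\<exists>A B. A \<noteq> {} \<and> B \<noteq> {} \<and> A \<inter> B = {} \<and> A \<union> B = \<Psi> \<and>
             (\<forall>\<alpha>\<in>A. \<forall>\<beta>\<in>B. form \<alpha> \<beta> = 0))"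

text \<open>The map \<open>f\<close> below is only constrained on the span of \<open>\<Psi>\<close>, where it has to be a
  linear isomorphism onto the span of \<open>X\<close>.\<close>

definition root_isomorphic ::
  "('v::real_vector \<Rightarrow> 'v \<Rightarrow> real) \<Rightarrow> 'v set \<Rightarrow>
   ('w::real_vector \<Rightarrow> 'w \<Rightarrow> real) \<Rightarrow> 'w set \<Rightarrow> bool" where
  "root_isomorphic form \<Psi> form' X \<longleftrightarrow>
     (\<exists>f. bij_betw f (span \<Psi>) (span X) \<and>
          (\<forall>x\<in>span \<Psi>. \<forall>y\<in>span \<Psi>. f (x + y) = f x + f y) \<and>
          (\<forall>c. \<forall>x\<in>span \<Psi>. f (c *\<^sub>R x) = c *\<^sub>R f x) \<and>
          f ` \<Psi> = X \<and>
          (\<forall>\<alpha>\<in>\<Psi>. \<forall>\<beta>\<in>\<Psi>. pairing form' (f \<beta>) (f \<alpha>) = pairing form \<beta> \<alpha>))"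

definition roots_A2_2 :: "'v::real_vector \<Rightarrow> 'v \<Rightarrow> 'v set" where
  "roots_A2_2 e1 d =
     {s *\<^sub>R e1 + (of_int r + 1/2) *\<^sub>R d | s r. s \<in> {1, -1} \<and> r \<in> (UNIV :: int set)} \<union>
     {s *\<^sub>R (2 *\<^sub>R e1) + (2 * of_int r) *\<^sub>R d | s r. s \<in> {1, -1} \<and> r \<in> (UNIV :: int set)}"

definition roots_A1_1 :: "'v::real_vector \<Rightarrow> 'v \<Rightarrow> 'v set" where
  "roots_A1_1 \<alpha> d =
     {s *\<^sub>R \<alpha> + of_int r *\<^sub>R d | s r. s \<in> {1, -1} \<and> r \<in> (UNIV :: int set)}"

text \<open>Both reference systems are taken in the given ambient space. For \<open>A\<^sub>1\<^sup>(\<^sup>1\<^sup>)\<close> the vector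
  \<open>\<epsilon>\<^sub>1\<close> serves as the simple root of \<open>A\<^sub>1\<close>; its normalization is immaterial, since the
  numbers \<open>pairing form \<beta> \<alpha>\<close> do not change when all finite parts are rescaled.\<close>

definition type_A2_2 ::
  "('v::real_vector \<Rightarrow> 'v \<Rightarrow> real) \<Rightarrow> 'v \<Rightarrow> 'v \<Rightarrow> 'v set \<Rightarrow> bool" where
  "type_A2_2 form e1 d \<Psi> \<longleftrightarrow>
     irreducible_roots form \<Psi> \<and> root_isomorphic form \<Psi> form (roots_A2_2 e1 d)"

definition type_A1_1 ::
  "('v::real_vector \<Rightarrow> 'v \<Rightarrow> real) \<Rightarrow> 'v \<Rightarrow> 'v \<Rightarrow> 'v set \<Rightarrow> bool" where
  "type_A1_1 form e1 d \<Psi> \<longleftrightarrow>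
     irreducible_roots form \<Psi> \<and> root_isomorphic form \<Psi> form (roots_A1_1 e1 d)"

definition gradient :: "'v::real_vector \<Rightarrow> 'v \<Rightarrow> 'v set \<Rightarrow> 'v set" where
  "gradient e1 d \<Psi> =
     {\<alpha> \<in> {e1, - e1, 2 *\<^sub>R e1, - (2 *\<^sub>R e1)}. \<exists>r::real. \<alpha> + r *\<^sub>R d \<in> \<Psi>}"

definition Psi_kq :: "'v::real_vector \<Rightarrow> 'v \<Rightarrow> nat \<Rightarrow> nat \<Rightarrow> 'v set" where
  "Psi_kq e1 d k q =
     {s *\<^sub>R (e1 + (real k + 1/2 + of_int r * real q) *\<^sub>R d)
        | s r. s \<in> {1, -1} \<and> r \<in> (UNIV :: int set)} \<union>
     {s *\<^sub>R (2 *\<^sub>R e1 + (2 * real k + 1 + (2 * of_int r + 1) * real q) *\<^sub>R d)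
        | s r. s \<in> {1, -1} \<and> r \<in> (UNIV :: int set)}"

definition Psi_short :: "'v::real_vector \<Rightarrow> 'v \<Rightarrow> real \<Rightarrow> 'v set" where
  "Psi_short e1 d c =
     {s *\<^sub>R (e1 + (2 * of_int r + c) *\<^sub>R d) | s r. s \<in> {1, -1} \<and> r \<in> (UNIV :: int set)}"

definition Psi_long :: "'v::real_vector \<Rightarrow> 'v \<Rightarrow> 'v set" where
  "Psi_long e1 d =
     {s *\<^sub>R (2 *\<^sub>R e1 + (2 * of_int r) *\<^sub>R d) | s r. s \<in> {1, -1} \<and> r \<in> (UNIV :: int set)}"

end

theory Submission
  imports Defs
begin

text \<open>
  Write \<open>short_root a = \<epsilon>\<^sub>1 + (a + 1/2)\<delta>\<close> and \<open>long_root m = 2\<epsilon>\<^sub>1 + 2m\<delta>\<close>. Since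
  \<open>s\<^sub>\<alpha>(\<alpha>) = -\<alpha>\<close>, a subroot system is stable under negation, so it is determined by the set \<open>S\<close> of
  integers \<open>a\<close> and the set \<open>L\<close> of integers \<open>m\<close> whose roots it contains. Reflections act on these
  integers as point reflections of the line, and \<open>\<delta>\<close> never contributes to the form, so being a
  closed subroot system becomes a purely arithmetic condition on \<open>S\<close> and \<open>L\<close>
  (\<open>closed_subroot_system_iff\<close>).

  If \<open>L\<close> is empty, all elements of \<open>S\<close> have the same parity, because two short roots of different
  parity add up to a long root. Both parity classes are closed, which gives the two systems of short
  roots. If \<open>S\<close> is empty, all long roots together form a closed system.

  If neither is empty, \<open>S\<close> and \<open>L\<close> are arithmetic progressions (\<open>reflection_stable_int_set\<close>). A long
  and a short root reflect each other, and the resulting congruences have the odd number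
  \<open>2m - 2a - 1\<close> in them. This forces a common odd modulus \<open>n\<close> and determines \<open>L\<close> from \<open>S\<close>
  (\<open>closed_pair_both_nonempty\<close>): \<open>S = {x. n dvd x - a}\<close>, \<open>L = {m. n dvd 2m - 2a - 1}\<close>. For
  \<open>n = 1\<close> this is all of \<open>\<Phi>\<close>; otherwise replacing \<open>n\<close> by a prime divisor \<open>q\<close> gives a larger closed
  proper subsystem, so maximality forces the modulus to be an odd prime.

  The types are read off from the shears \<open>\<epsilon>\<^sub>1 \<mapsto> c \<epsilon>\<^sub>1 + t \<delta>\<close>, \<open>\<delta> \<mapsto> u \<delta>\<close>, which multiply the form on
  the plane by \<open>c\<^sup>2\<close> and hence preserve all pairings (\<open>root_isomorphic_shear\<close>).
\<close>

section \<open>Integer sets stable under point reflections\<close>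

text \<open>If \<open>a\<close> and \<open>a + g\<close> are two elements at minimal distance, reflecting them alternately in each
  other produces the whole progression \<open>a + g\<int>\<close>, and a further element would fall into a gap at
  distance less than \<open>g\<close>. The value \<open>g = 0\<close> covers singletons.\<close>

lemma reflection_stable_int_set:
  fixes S :: "int set"
  assumes refl: "\<And>a b. a \<in> S \<Longrightarrow> b \<in> S \<Longrightarrow> 2 * a - b \<in> S" and "c \<in> S"
  obtains a g where "g \<ge> 0" and "S = {x. g dvd x - a}"
proof (cases "S = {c}")
  case True
  then have "S = {x. 0 dvd x - c}" by auto
  then show ?thesis using that[of 0 c] by simp
next
  case False
  define D where "D = {n::nat. n > 0 \<and> (\<exists>a\<in>S. a + int n \<in> S)}"
  from False \<open>c \<in> S\<close> obtain b where b: "b \<in> S" "b \<noteq> c" by blast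
  then have "nat \<bar>b - c\<bar> \<in> D"
    using \<open>c \<in> S\<close> unfolding D_def by (cases "b < c") (auto intro: bexI[of _ b] bexI[of _ c])
  then have ex: "\<exists>n. n \<in> D" by blast
  define g where "g = (LEAST n. n \<in> D)"
  have "g \<in> D" unfolding g_def using ex by (rule LeastI_ex)
  then obtain a where a: "a \<in> S" "a + int g \<in> S" and g0: "g > 0" by (auto simp: D_def)
  have min: "\<not> (x < y \<and> y < x + int g)" if "x \<in> S" "y \<in> S" for x y
  proof
    assume *: "x < y \<and> y < x + int g"
    then have "nat (y - x) \<in> D" using that by (auto simp: D_def intro!: bexI[of _ x])
    then have "g \<le> nat (y - x)" unfolding g_def by (rule Least_le)
    with * show False by linarith
  qed
  have up: "a + int n * int g \<in> S \<and> a + (int n + 1) * int g \<in> S" for n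
  proof (induction n)
    case (Suc n)
    have "2 * (a + (int n + 1) * int g) - (a + int n * int g) \<in> S" using Suc refl by blast
    moreover have "2 * (a + (int n + 1) * int g) - (a + int n * int g)
        = a + (int (Suc n) + 1) * int g" by (simp add: algebra_simps)
    ultimately show ?case using Suc by (simp add: algebra_simps)
  qed (use a in simp)
  have prog: "a + r * int g \<in> S" for r
  proof (cases "r \<ge> 0")
    case True
    then show ?thesis using up[of "nat r"] by simp
  next
    case False
    then have "2 * a - (a + int (nat (- r)) * int g) \<in> S" using up a refl by blast
    with False show ?thesis by (simp add: algebra_simps)
  qed
  have "S = {x. int g dvd x - a}"
  proof (intro equalityI subsetI CollectI)
    fix x assume "x \<in> S"
    \<comment> \<open>The progression point just below \<open>x\<close> is closer to \<open>x\<close> than the minimal distance.\<close>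
    let ?y = "a + ((x - a) div int g) * int g"
    have eq: "x = ?y + (x - a) mod int g" using div_mult_mod_eq[of "x - a" "int g"] by linarith
    have lt: "(x - a) mod int g < int g" and ge: "(x - a) mod int g \<ge> 0" using g0 by simp_all
    have "\<not> (?y < x \<and> x < ?y + int g)" using min[OF prog \<open>x \<in> S\<close>] .
    then have "(x - a) mod int g = 0" using eq lt ge by linarith
    then show "int g dvd x - a" by presburger
  next
    fix x assume "x \<in> {x. int g dvd x - a}"
    then obtain r where "x - a = int g * r" by (auto simp: dvd_def)
    then have "x = a + r * int g" by (simp add: algebra_simps)
    then show "x \<in> S" using prog by simp
  qed
  then show ?thesis using that[of "int g" a] by simp
qed

section \<open>Closed subsystems as pairs of integer sets\<close>

text \<open>The clauses record, in this order: non-emptiness; reflecting short in short roots and long in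
  long roots; reflecting long in short roots and vice versa; and the sum of two short roots. The sum
  of a long root and the negative of a short root gives the short root \<open>2m - 1 - a\<close> again, so closure
  under such sums already follows from the reflections.\<close>

definition closed_pair :: "int set \<Rightarrow> int set \<Rightarrow> bool" where
  "closed_pair S L \<longleftrightarrow> S \<union> L \<noteq> {} \<and>
     (\<forall>a\<in>S. \<forall>b\<in>S. 2 * a - b \<in> S) \<and>
     (\<forall>m\<in>L. \<forall>n\<in>L. 2 * m - n \<in> L) \<and>
     (\<forall>a\<in>S. \<forall>m\<in>L. 2 * a + 1 - m \<in> L \<and> 2 * m - 1 - a \<in> S) \<and>
     (\<forall>a\<in>S. \<forall>b\<in>S. \<forall>m. 2 * m = a + b + 1 \<longrightarrow> m \<in> L)"

lemma closed_pair_congruence: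
  "closed_pair {x. n dvd x - a} {m. n dvd 2 * m - 2 * a - 1}"
proof -
  have "n dvd 2 * x - y - a" if "n dvd x - a" "n dvd y - a" for x y
    using dvd_diff[OF dvd_mult[OF that(1), of 2] that(2)] by (simp add: algebra_simps)
  moreover have "n dvd 2 * (2 * m - l) - 2 * a - 1"
    if "n dvd 2 * m - 2 * a - 1" "n dvd 2 * l - 2 * a - 1" for m l
    using dvd_diff[OF dvd_mult[OF that(1), of 2] that(2)] by (simp add: algebra_simps)
  moreover have "n dvd 2 * (2 * x + 1 - m) - 2 * a - 1"
    if "n dvd x - a" "n dvd 2 * m - 2 * a - 1" for x m
    using dvd_diff[OF dvd_mult[OF that(1), of 4] that(2)] by (simp add: algebra_simps)
  moreover have "n dvd 2 * m - 1 - x - a"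
    if "n dvd x - a" "n dvd 2 * m - 2 * a - 1" for x m
    using dvd_diff[OF that(2) that(1)] by (simp add: algebra_simps)
  moreover have "n dvd 2 * m - 2 * a - 1"
    if "n dvd x - a" "n dvd y - a" "2 * m = x + y + 1" for x y m
    using dvd_add[OF that(1,2)] that(3) by (simp add: algebra_simps)
  moreover have "a \<in> {x. n dvd x - a}" by simp
  ultimately show ?thesis unfolding closed_pair_def by blast
qed

text \<open>Within one parity class, \<open>a + b + 1\<close> is odd, so no two short roots add up to a root.\<close>

lemma closed_pair_parity: "closed_pair {a. even (a - c)} {}"
proof -
  have "c \<in> {a. even (a - c)}" by simp
  moreover have "even (2 * a - b - c)" if "even (a - c)" "even (b - c)" for a b
    using that by presburger
  moreover have False if "even (a - c)" "even (b - c)" "2 * m = a + b + 1" for a b m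
    using that by presburger
  ultimately show ?thesis unfolding closed_pair_def by blast
qed

text \<open>Let \<open>g\<close> and \<open>h\<close> be the moduli of \<open>S\<close> and \<open>L\<close>. Both divide the odd number \<open>2b - 2a - 1\<close>, hence
  are odd (and, in particular, non-zero). Composing two reflections shifts \<open>L\<close> by \<open>2g\<close> and \<open>S\<close> by
  \<open>2h\<close>, so \<open>h\<close> divides \<open>2g\<close> and \<open>g\<close> divides \<open>2h\<close>; as both are odd, they agree. The description of
  \<open>L\<close> by a condition on \<open>2m\<close> avoids the inverse of \<open>2\<close> modulo \<open>n\<close>.\<close>

lemma closed_pair_both_nonempty:
  assumes cp: "closed_pair S L" and "S \<noteq> {}" "L \<noteq> {}"
  obtains n a where "n \<ge> 0" "odd n" "S = {x. n dvd x - a}" "L = {m. n dvd 2 * m - 2 * a - 1}"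
proof -
  from assms obtain s l where sl: "s \<in> S" "l \<in> L" by blast
  obtain a g where g: "g \<ge> 0" and S: "S = {x. g dvd x - a}"
    using cp sl reflection_stable_int_set[of S s] unfolding closed_pair_def by metis
  obtain b h where h: "h \<ge> 0" and L: "L = {x. h dvd x - b}"
    using cp sl reflection_stable_int_set[of L l] unfolding closed_pair_def by metis
  have aS: "a \<in> S" "a + g \<in> S" and bL: "b \<in> L" "b + h \<in> L" using S L by auto
  have toL: "2 * x + 1 - m \<in> L" and toS: "2 * m - 1 - x \<in> S" if "x \<in> S" "m \<in> L" for x m
    using cp that unfolding closed_pair_def by blast+
  have h1: "h dvd 2 * a + 1 - b - b" and h2: "h dvd 2 * (a + g) + 1 - b - b"
    using toL[OF aS(1) bL(1)] toL[OF aS(2) bL(1)] L by auto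
  have g1: "g dvd 2 * b - 1 - a - a" and g2: "g dvd 2 * (b + h) - 1 - a - a"
    using toS[OF aS(1) bL(1)] toS[OF aS(1) bL(2)] S by auto
  have "odd (2 * a + 1 - b - b)" "odd (2 * b - 1 - a - a)" by presburger+
  then have odd: "odd h" "odd g" using h1 g1 dvd_trans by blast+
  have "h dvd 2 * g" using dvd_diff[OF h2 h1] by (simp add: algebra_simps)
  then have hg: "h dvd g" using odd by (simp add: coprime_dvd_mult_right_iff)
  have "g dvd 2 * h" using dvd_diff[OF g2 g1] by (simp add: algebra_simps)
  then have "g dvd h" using odd by (simp add: coprime_dvd_mult_right_iff)
  then have gh: "g = h" using hg g h by (simp add: zdvd_antisym_nonneg)
  have "L = {m. g dvd 2 * m - 2 * a - 1}"
  proof -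
    have "g dvd m - b \<longleftrightarrow> g dvd 2 * m - 2 * a - 1" for m
    proof -
      have "coprime g 2" using odd by simp
      then have "g dvd m - b \<longleftrightarrow> g dvd 2 * (m - b)" by (rule coprime_dvd_mult_right_iff[symmetric])
      also have "\<dots> \<longleftrightarrow> g dvd 2 * (m - b) + (2 * b - 1 - a - a)"
        using g1 by (rule dvd_add_left_iff[symmetric])
      also have "2 * (m - b) + (2 * b - 1 - a - a) = 2 * m - 2 * a - 1" by simp
      finally show ?thesis .
    qed
    then show ?thesis using L gh by simp
  qed
  then show ?thesis using that[of g a] g odd S by blast
qed

section \<open>Root systems given by their positive part\<close>

definition symmetrize :: "'v::real_vector set \<Rightarrow> 'v set" where
  "symmetrize A = A \<union> uminus ` A"

lemma uminus_mem_symmetrize_iff [simp]: "- x \<in> symmetrize A \<longleftrightarrow> x \<in> symmetrize A"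
  unfolding symmetrize_def by force

lemma symmetrize_eq_signed: "symmetrize (range f) = {s *\<^sub>R f r | s r. s \<in> {1, -1} \<and> r \<in> UNIV}"
  unfolding symmetrize_def by force

lemma symmetrize_Un: "symmetrize (A \<union> B) = symmetrize A \<union> symmetrize B"
  unfolding symmetrize_def by blast

lemma linear_image_symmetrize:
  "linear f \<Longrightarrow> f ` symmetrize A = symmetrize (f ` A)"
  unfolding symmetrize_def by (auto simp: image_Un image_image linear_neg)

text \<open>On the span of \<open>\<epsilon>\<^sub>1\<close> and \<open>\<delta>\<close> the form is \<open>(x \<epsilon>\<^sub>1 + y \<delta>, x' \<epsilon>\<^sub>1 + y' \<delta>) = x x'\<close>, so pairing a vector
  with \<open>\<epsilon>\<^sub>1\<close> recovers its first coordinate. Coordinates are therefore unique as soon as \<open>\<delta> \<noteq> 0\<close>.\<close>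

locale degenerate_plane =
  fixes form :: "'v::real_vector \<Rightarrow> 'v \<Rightarrow> real" and e1 d :: 'v
  assumes bilinear: "bilinear form"
    and sym: "form x y = form y x"
    and norm_e1: "form e1 e1 = 1"
    and null: "form d x = 0"
    and d_nonzero: "d \<noteq> 0"
begin

abbreviation vec :: "real \<Rightarrow> real \<Rightarrow> 'v" where
  "vec x y \<equiv> x *\<^sub>R e1 + y *\<^sub>R d"

definition short_root :: "int \<Rightarrow> 'v" where "short_root a = e1 + (of_int a + 1/2) *\<^sub>R d"
definition long_root :: "int \<Rightarrow> 'v" where "long_root m = 2 *\<^sub>R e1 + (2 * of_int m) *\<^sub>R d"

definition system :: "int set \<Rightarrow> int set \<Rightarrow> 'v set" where
  "system S L = symmetrize (short_root ` S \<union> long_root ` L)"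

abbreviation \<Phi> :: "'v set" where "\<Phi> \<equiv> roots_A2_2 e1 d"

lemma form_null_right: "form x d = 0"
  using sym[of x d] null by simp

lemma form_vec: "form (vec x y) (vec x' y') = x * x'"
  using bilinear norm_e1 null form_null_right
  by (simp add: bilinear_ladd bilinear_radd bilinear_lmul bilinear_rmul)

lemma form_vec_e1: "form (vec x y) e1 = x"
  using form_vec[of x y 1 0] by simp

lemma vec_eq_iff: "vec x y = vec x' y' \<longleftrightarrow> x = x' \<and> y = y'"
proof
  assume eq: "vec x y = vec x' y'"
  then have "x = x'" using form_vec_e1 by metis
  with eq show "x = x' \<and> y = y'" using d_nonzero by simp
qed simp

lemma short_root_vec: "short_root a = vec 1 (of_int a + 1/2)"
  and long_root_vec: "long_root m = vec 2 (2 * of_int m)"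
  by (simp_all add: short_root_def long_root_def)

lemma vec_add: "vec x y + vec x' y' = vec (x + x') (y + y')"
  and vec_diff: "vec x y - vec x' y' = vec (x - x') (y - y')"
  and vec_scale: "s *\<^sub>R vec x y = vec (s * x) (s * y)"
  by (simp_all add: algebra_simps)

lemma uminus_vec: "- vec x y = vec (- x) (- y)"
  by simp

text \<open>The statements that a sum or difference of roots is not a root reduce to arithmetic of
  coordinates by this equivalence.\<close>

lemma vec_mem_system:
  "vec x y \<in> system S L \<longleftrightarrow>
     (\<exists>a\<in>S. x = 1 \<and> y = of_int a + 1/2 \<or> x = -1 \<and> y = - (of_int a + 1/2)) \<or>
     (\<exists>m\<in>L. x = 2 \<and> y = 2 * of_int m \<or> x = -2 \<and> y = - (2 * of_int m))"
proof -
  have "vec x y \<in> system S L \<longleftrightarrow>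
      (\<exists>a\<in>S. vec x y = vec 1 (of_int a + 1/2) \<or> vec x y = - vec 1 (of_int a + 1/2)) \<or>
      (\<exists>m\<in>L. vec x y = vec 2 (2 * of_int m) \<or> vec x y = - vec 2 (2 * of_int m))"
    unfolding system_def symmetrize_def short_root_vec long_root_vec by blast
  then show ?thesis unfolding uminus_vec vec_eq_iff by auto
qed

lemma short_root_mem_system [simp]: "short_root a \<in> system S L \<longleftrightarrow> a \<in> S"
  unfolding short_root_vec vec_mem_system by auto

lemma long_root_mem_system [simp]: "long_root m \<in> system S L \<longleftrightarrow> m \<in> L"
  unfolding long_root_vec vec_mem_system by auto

lemma uminus_mem_system [simp]: "- x \<in> system S L \<longleftrightarrow> x \<in> system S L"
  by (simp add: system_def)

lemma system_cases:
  assumes "x \<in> system S L"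
  obtains a where "a \<in> S" "x = short_root a \<or> x = - short_root a"
  | m where "m \<in> L" "x = long_root m \<or> x = - long_root m"
  using assms unfolding system_def symmetrize_def by blast

lemma system_elem_vec:
  assumes "x \<in> system S L"
  obtains p t where "x = vec p t" "p \<noteq> 0"
proof -
  from assms have "\<exists>p t. x = vec p t"
    by (rule system_cases) (metis short_root_vec long_root_vec uminus_vec)+
  then obtain p t where x: "x = vec p t" by blast
  then have "p \<noteq> 0" using assms unfolding x vec_mem_system by auto
  with x show ?thesis by (rule that)
qed

lemma system_mono_iff: "system S L \<subseteq> system S' L' \<longleftrightarrow> S \<subseteq> S' \<and> L \<subseteq> L'"
proof
  assume "system S L \<subseteq> system S' L'"
  then show "S \<subseteq> S' \<and> L \<subseteq> L'"
    by (metis long_root_mem_system short_root_mem_system subset_iff)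
qed (auto simp: system_def symmetrize_def)

lemma system_eq_iff: "system S L = system S' L' \<longleftrightarrow> S = S' \<and> L = L'"
  by (metis subset_antisym subset_refl system_mono_iff)

lemma roots_A2_2_eq_system: "\<Phi> = system UNIV UNIV"
proof (intro equalityI subsetI)
  fix x assume "x \<in> \<Phi>"
  then consider (short) s :: real and r :: int where "s \<in> {1, -1}" "x = vec s (of_int r + 1/2)"
    | (long) s :: real and r :: int where "s \<in> {1, -1}" "x = vec (2 * s) (2 * of_int r)"
    unfolding roots_A2_2_def by (auto simp: mult.commute)
  then show "x \<in> system UNIV UNIV"
  proof cases
    case short
    \<comment> \<open>Because of the half-integral offset, negation sends the index \<open>r\<close> to \<open>- r - 1\<close>.\<close>
    have "of_int r + 1/2 = - (of_int (- r - 1) + 1/2 :: real)" by simp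
    with short show ?thesis unfolding short(2) vec_mem_system by blast
  next
    case long
    then show ?thesis
      unfolding long(2) vec_mem_system by (auto intro: exI[of _ r] exI[of _ "- r"])
  qed
next
  fix x assume "x \<in> system UNIV UNIV"
  moreover have "short_root a \<in> \<Phi>" for a
  proof -
    have "short_root a = 1 *\<^sub>R e1 + (of_int a + 1/2) *\<^sub>R d" by (simp add: short_root_def)
    then show ?thesis unfolding roots_A2_2_def by blast
  qed
  moreover have "- short_root a \<in> \<Phi>" for a
  proof -
    have "- short_root a = (-1) *\<^sub>R e1 + (of_int (- a - 1) + 1/2) *\<^sub>R d"
      by (simp add: short_root_def algebra_simps)
    then show ?thesis unfolding roots_A2_2_def by blast
  qed
  moreover have "long_root m \<in> \<Phi>" for m
  proof -
    have "long_root m = 1 *\<^sub>R (2 *\<^sub>R e1) + (2 * of_int m) *\<^sub>R d"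
      by (simp add: long_root_def)
    then show ?thesis unfolding roots_A2_2_def by blast
  qed
  moreover have "- long_root m \<in> \<Phi>" for m
  proof -
    have "- long_root m = (-1) *\<^sub>R (2 *\<^sub>R e1) + (2 * of_int (- m)) *\<^sub>R d"
      by (simp add: long_root_def)
    then show ?thesis unfolding roots_A2_2_def by blast
  qed
  ultimately show "x \<in> \<Phi>" by (metis system_cases)
qed

lemma reflect_vec:
  assumes "x \<noteq> 0"
  shows "reflect form (vec x y) (vec x' y') = vec (- x') (y' - 2 * x' / x * y)"
  unfolding reflect_def pairing_def form_vec vec_scale vec_diff vec_eq_iff
  using assms by simp

lemma reflect_uminus_left: "reflect form (- x) y = reflect form x y"
  using bilinear by (simp add: reflect_def pairing_def bilinear_lneg bilinear_rneg)

lemma reflect_uminus_right: "reflect form x (- y) = - reflect form x y"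
  using bilinear by (simp add: reflect_def pairing_def bilinear_lneg)

lemma reflect_roots:
  "reflect form (short_root a) (short_root b) = - short_root (2 * a - b)"
  "reflect form (short_root a) (long_root m) = - long_root (2 * a + 1 - m)"
  "reflect form (long_root m) (short_root a) = - short_root (2 * m - 1 - a)"
  "reflect form (long_root m) (long_root n) = - long_root (2 * m - n)"
  unfolding short_root_vec long_root_vec uminus_vec reflect_vec[OF one_neq_zero]
    reflect_vec[OF zero_neq_numeral[symmetric]] vec_eq_iff
  by (simp_all add: algebra_simps)

text \<open>The translation of the geometric conditions into arithmetic. Sums other than those of two short
  roots of the same sign, or of a long root and a short root of opposite signs, are never roots: the
  \<open>\<epsilon>\<^sub>1\<close>-coordinate would be \<open>0\<close>, \<open>\<plusminus>3\<close> or \<open>\<plusminus>4\<close>.\<close>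

lemma closed_subroot_system_iff:
  "closed_subroot_system form \<Phi> (system S L) \<longleftrightarrow> closed_pair S L"
proof
  assume cl: "closed_subroot_system form \<Phi> (system S L)"
  then have refl: "reflect form x y \<in> system S L" if "x \<in> system S L" "y \<in> system S L" for x y
    using that by (auto simp: closed_subroot_system_def subroot_system_def)
  have add: "x + y \<in> system S L" if "x \<in> system S L" "y \<in> system S L" "x + y \<in> \<Phi>" for x y
    using cl that by (auto simp: closed_subroot_system_def)
  have "S \<union> L \<noteq> {}"
    using cl by (auto simp: closed_subroot_system_def subroot_system_def system_def symmetrize_def)
  moreover have "2 * a - b \<in> S" if "a \<in> S" "b \<in> S" for a b
    using refl[of "short_root a" "short_root b"] that by (simp add: reflect_roots)
  moreover have "2 * m - n \<in> L" if "m \<in> L" "n \<in> L" for m n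
    using refl[of "long_root m" "long_root n"] that by (simp add: reflect_roots)
  moreover have "2 * a + 1 - m \<in> L" "2 * m - 1 - a \<in> S" if "a \<in> S" "m \<in> L" for a m
    using refl[of "short_root a" "long_root m"] refl[of "long_root m" "short_root a"] that
    by (simp_all add: reflect_roots)
  moreover have "m \<in> L" if "a \<in> S" "b \<in> S" "2 * m = a + b + 1" for a b m
  proof -
    have "2 * real_of_int m = of_int a + of_int b + 1" using that(3) by linarith
    then have "short_root a + short_root b = long_root m"
      unfolding short_root_vec long_root_vec vec_add vec_eq_iff by simp
    then show ?thesis using add[of "short_root a" "short_root b"] that
      by (simp add: roots_A2_2_eq_system)
  qed
  ultimately show "closed_pair S L" unfolding closed_pair_def by blast
next
  assume cp: "closed_pair S L"
  have "system S L \<noteq> {}"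
    using cp by (auto simp: closed_pair_def system_def symmetrize_def)
  moreover have "system S L \<subseteq> \<Phi>"
    unfolding roots_A2_2_eq_system system_mono_iff by simp
  moreover have "reflect form x y \<in> system S L" if "x \<in> system S L" "y \<in> system S L" for x y
  proof -
    have "reflect form (short_root a) y \<in> system S L" if "a \<in> S" for a
      using \<open>y \<in> system S L\<close>
      by (rule system_cases)
        (use cp that in \<open>auto simp: reflect_roots reflect_uminus_right closed_pair_def\<close>)
    moreover have "reflect form (long_root m) y \<in> system S L" if "m \<in> L" for m
      using \<open>y \<in> system S L\<close>
      by (rule system_cases)
        (use cp that in \<open>auto simp: reflect_roots reflect_uminus_right closed_pair_def\<close>)
    ultimately show ?thesis
      using \<open>x \<in> system S L\<close> by (metis reflect_uminus_left system_cases)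
  qed
  moreover have "x + y \<in> system S L"
    if xy: "x \<in> system S L" "y \<in> system S L" and sum: "x + y \<in> \<Phi>" for x y
  proof -
    have SS: "m \<in> L" if "a \<in> S" "b \<in> S" "real_of_int a + of_int b + 1 = 2 * of_int m" for a b m
    proof -
      have "2 * m = a + b + 1" using that(3) by linarith
      then show ?thesis using cp that by (auto simp: closed_pair_def)
    qed
    have short_plus: "short_root a + short_root b \<in> system S L"
      if "a \<in> S" "b \<in> S" "short_root a + short_root b \<in> \<Phi>" for a b
      using that SS[OF that(1,2)]
      unfolding roots_A2_2_eq_system short_root_vec vec_add vec_mem_system by auto
    have short_minus: "short_root a - short_root b \<notin> \<Phi>" for a b
      unfolding roots_A2_2_eq_system short_root_vec vec_diff vec_mem_system by auto
    have long_short_plus: "long_root m + short_root a \<notin> \<Phi>" for a m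
      unfolding roots_A2_2_eq_system short_root_vec long_root_vec vec_add vec_mem_system by auto
    have long_short_minus: "long_root m - short_root a \<in> system S L" if "a \<in> S" "m \<in> L" for a m
    proof -
      have "long_root m - short_root a = short_root (2 * m - 1 - a)"
        unfolding short_root_vec long_root_vec vec_diff vec_eq_iff by simp
      then show ?thesis using cp that by (simp add: closed_pair_def)
    qed
    have long_plus: "long_root m + long_root n \<notin> \<Phi>"
      and long_minus: "long_root m - long_root n \<notin> \<Phi>" for m n
      unfolding roots_A2_2_eq_system long_root_vec vec_add vec_diff vec_mem_system by auto
    \<comment> \<open>Both sides are stable under negation, so up to an overall sign only sums and differences
      of positive roots matter.\<close>
    define P where "P = short_root ` S \<union> long_root ` L"
    have neg: "u - v \<in> \<Phi> \<longleftrightarrow> v - u \<in> \<Phi>" "u - v \<in> system S L \<longleftrightarrow> v - u \<in> system S L" for u v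
      unfolding roots_A2_2_eq_system by (metis minus_diff_eq uminus_mem_system)+
    have pos: "(u + v \<in> \<Phi> \<longrightarrow> u + v \<in> system S L) \<and> (u - v \<in> \<Phi> \<longrightarrow> u - v \<in> system S L)"
      if u: "u \<in> P" and v: "v \<in> P" for u v
    proof -
      consider a b where "u = short_root a" "v = short_root b" "a \<in> S" "b \<in> S"
        | m a where "u = long_root m" "v = short_root a" "m \<in> L" "a \<in> S"
        | a m where "u = short_root a" "v = long_root m" "a \<in> S" "m \<in> L"
        | m n where "u = long_root m" "v = long_root n"
        using u v unfolding P_def by blast
      then show ?thesis
      proof cases
        case 1
        then show ?thesis using short_plus short_minus by blast
      next
        case 2
        then show ?thesis using long_short_plus long_short_minus by blast
      next
        case 3
        then have "u + v \<notin> \<Phi>" using long_short_plus[of m a] by (simp only: add.commute) simp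
        then show ?thesis using 3 neg long_short_minus by blast
      next
        case 4
        then show ?thesis using long_plus long_minus by blast
      qed
    qed
    obtain u v where uv: "u \<in> P" "v \<in> P" and x: "x = u \<or> x = - u" and y: "y = v \<or> y = - v"
      using xy unfolding system_def symmetrize_def P_def by blast
    have "x + y = u + v \<or> x + y = - (u + v) \<or> x + y = u - v \<or> x + y = - (u - v)"
      using x y by auto
    then show ?thesis
      using pos[OF uv] sum uminus_mem_system unfolding roots_A2_2_eq_system by metis
  qed
  ultimately show "closed_subroot_system form \<Phi> (system S L)"
    unfolding closed_subroot_system_def subroot_system_def by blast
qed

text \<open>Reflecting a root in itself negates it, so the positive roots determine the subsystem.\<close>

lemma closed_subroot_system_eq_system:
  assumes "closed_subroot_system form \<Phi> \<Psi>"
  shows "\<Psi> = system {a. short_root a \<in> \<Psi>} {m. long_root m \<in> \<Psi>}"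
proof -
  have sub: "\<Psi> \<subseteq> \<Phi>" and refl: "\<And>x. x \<in> \<Psi> \<Longrightarrow> reflect form x x \<in> \<Psi>"
    using assms by (auto simp: closed_subroot_system_def subroot_system_def)
  have neg: "- x \<in> \<Psi>" if "x \<in> \<Psi>" for x
  proof -
    have "x \<in> system UNIV UNIV" using that sub roots_A2_2_eq_system by blast
    then have "form x x \<noteq> 0" by (rule system_elem_vec) (simp only: form_vec, simp)
    then have "reflect form x x = - x" by (simp add: reflect_def pairing_def scaleR_2)
    then show ?thesis using refl[OF that] by simp
  qed
  show ?thesis
  proof (intro equalityI subsetI)
    fix x assume "x \<in> \<Psi>"
    then have "x \<in> system UNIV UNIV" using sub roots_A2_2_eq_system by blast
    then show "x \<in> system {a. short_root a \<in> \<Psi>} {m. long_root m \<in> \<Psi>}"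
      by (rule system_cases) (use neg[OF \<open>x \<in> \<Psi>\<close>] \<open>x \<in> \<Psi>\<close> in auto)
  next
    fix x assume "x \<in> system {a. short_root a \<in> \<Psi>} {m. long_root m \<in> \<Psi>}"
    then show "x \<in> \<Psi>" by (rule system_cases) (auto intro: neg)
  qed
qed

lemma gradient_system:
  "gradient e1 d (system S L) =
     (if S = {} then {} else {e1, - e1}) \<union> (if L = {} then {} else {2 *\<^sub>R e1, - (2 *\<^sub>R e1)})"
proof -
  have short: "(\<exists>r. vec 1 r \<in> system S L) \<longleftrightarrow> S \<noteq> {}" "(\<exists>r. vec (-1) r \<in> system S L) \<longleftrightarrow> S \<noteq> {}"
    and long: "(\<exists>r. vec 2 r \<in> system S L) \<longleftrightarrow> L \<noteq> {}" "(\<exists>r. vec (-2) r \<in> system S L) \<longleftrightarrow> L \<noteq> {}"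
    unfolding vec_mem_system by auto
  show ?thesis unfolding gradient_def using short long by auto
qed

section \<open>The systems of the classification\<close>

lemma Psi_short_eq_system:
  "Psi_short e1 d (1/2) = system {a. even a} {}"
  "Psi_short e1 d (3/2) = system {a. odd a} {}"
proof -
  have "{a::int. even a} = range (\<lambda>r. 2 * r)" "{a::int. odd a} = range (\<lambda>r. 2 * r + 1)"
    by (auto elim: evenE oddE)
  then show "Psi_short e1 d (1/2) = system {a. even a} {}"
    "Psi_short e1 d (3/2) = system {a. odd a} {}"
    by (simp_all add: Psi_short_def system_def image_image symmetrize_eq_signed short_root_def
        add.assoc)
qed

lemma Psi_long_eq_system: "Psi_long e1 d = system {} UNIV"
  by (simp add: Psi_long_def system_def symmetrize_eq_signed long_root_def)

text \<open>If \<open>q\<close> divides the odd number \<open>2m - 2k - 1\<close>, the quotient is an odd number \<open>2r + 1\<close>, and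
  solving for \<open>m\<close> gives \<open>m = k + (q + 1)/2 + r q\<close>. This matches the congruence classes with the
  parametrised families in \<open>Psi_kq\<close>.\<close>

lemma odd_modulus_classes_eq_range:
  assumes "odd q"
  shows "{x. int q dvd x - k} = range (\<lambda>r. k + r * int q)"
    and "{m. int q dvd 2 * m - 2 * k - 1} = range (\<lambda>r. k + 1 + int (q div 2) + r * int q)"
proof -
  obtain p where q: "q = 2 * p + 1" using assms by (rule oddE)
  show "{x. int q dvd x - k} = range (\<lambda>r. k + r * int q)"
    by (auto simp: dvd_def image_iff algebra_simps)
  show "{m. int q dvd 2 * m - 2 * k - 1} = range (\<lambda>r. k + 1 + int (q div 2) + r * int q)"
  proof (intro equalityI subsetI)
    fix m assume "m \<in> {m. int q dvd 2 * m - 2 * k - 1}"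
    then obtain c where c: "2 * m - 2 * k - 1 = int q * c" by (auto simp: dvd_def)
    have "odd (2 * m - 2 * k - 1)" by simp
    then have "odd c" unfolding c by simp
    then obtain r where "c = 2 * r + 1" by (rule oddE)
    then have "m = k + 1 + int (q div 2) + r * int q" using c by (simp add: q algebra_simps)
    then show "m \<in> range (\<lambda>r. k + 1 + int (q div 2) + r * int q)" by blast
  next
    fix m assume "m \<in> range (\<lambda>r. k + 1 + int (q div 2) + r * int q)"
    then obtain r where "m = k + 1 + int (q div 2) + r * int q" by blast
    then have "2 * m - 2 * k - 1 = int q * (2 * r + 1)" by (simp add: q algebra_simps)
    then show "m \<in> {m. int q dvd 2 * m - 2 * k - 1}" by simp
  qed
qed

lemma double_long_offset:
  assumes "odd q"
  shows "2 * real_of_int (int k + 1 + int (q div 2) + r * int q)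
    = 2 * real k + 1 + (2 * of_int r + 1) * real q"
proof -
  obtain p where "q = 2 * p + 1" using assms by (rule oddE)
  then show ?thesis by (simp add: algebra_simps)
qed

lemma Psi_kq_eq_system:
  assumes "odd q"
  shows "Psi_kq e1 d k q = system {x. int q dvd x - int k} {m. int q dvd 2 * m - 2 * int k - 1}"
proof -
  have "short_root (int k + r * int q) = e1 + (real k + 1/2 + of_int r * real q) *\<^sub>R d" for r
    by (simp add: short_root_def algebra_simps)
  moreover have "long_root (int k + 1 + int (q div 2) + r * int q) =
      2 *\<^sub>R e1 + (2 * real k + 1 + (2 * of_int r + 1) * real q) *\<^sub>R d" for r
    by (simp only: long_root_def double_long_offset[OF assms])
  ultimately show ?thesis
    unfolding system_def odd_modulus_classes_eq_range[OF assms] symmetrize_Un image_image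
      symmetrize_eq_signed Psi_kq_def by simp
qed

section \<open>Types\<close>

text \<open>The shear \<open>\<epsilon>\<^sub>1 \<mapsto> c \<epsilon>\<^sub>1 + t \<delta>\<close>, \<open>\<delta> \<mapsto> u \<delta>\<close> multiplies the form by \<open>c\<^sup>2\<close>, which cancels in the
  quotient defining the pairing.\<close>

lemma root_isomorphic_shear:
  assumes c: "c \<noteq> 0" and u: "u \<noteq> 0"
  shows "root_isomorphic form (system S L) form
    (symmetrize ((\<lambda>a. vec c (t + u * (of_int a + 1/2))) ` S \<union>
                 (\<lambda>m. vec (2 * c) (2 * t + u * (2 * of_int m))) ` L))"
    (is "root_isomorphic form ?\<Psi> form ?X")
proof -
  \<comment> \<open>Multiplication by \<open>u\<close>, corrected by a rank-one map that vanishes on \<open>\<delta>\<close>. This extends the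
    shear to a linear injection of the whole space, so the spans of a set and of its image
    correspond.\<close>
  define f where "f x = u *\<^sub>R x + form x e1 *\<^sub>R vec (c - u) t" for x
  have lin: "linear f"
    unfolding f_def using bilinear
    by (intro linearI) (simp_all add: bilinear_ladd bilinear_lmul algebra_simps)
  have f_vec: "f (vec x y) = vec (c * x) (t * x + u * y)" for x y
    unfolding f_def form_vec_e1 vec_scale vec_add vec_eq_iff by (simp add: algebra_simps)
  have "inj f"
  proof (rule linear_injective_0[OF lin, THEN iffD2], intro allI impI)
    fix x assume 0: "f x = 0"
    have "form (f x) e1 = u * form x e1 + form x e1 * (c - u)"
      using bilinear form_vec_e1 unfolding f_def by (simp only: bilinear_ladd bilinear_lmul) simp
    also have "\<dots> = c * form x e1" by (simp add: algebra_simps)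
    finally have "form x e1 = 0" using 0 c bilinear by (simp add: bilinear_lzero)
    then show "x = 0" using 0 u by (simp add: f_def)
  qed
  then have "inj_on f (span ?\<Psi>)" by (rule inj_on_subset) simp
  then have "bij_betw f (span ?\<Psi>) (span (f ` ?\<Psi>))"
    by (simp add: bij_betw_def linear_span_image[OF lin])
  moreover have "pairing form (f y) (f x) = pairing form y x" if x: "x \<in> ?\<Psi>" and y: "y \<in> ?\<Psi>" for x y
  proof -
    obtain p r p' r' where "x = vec p r" "y = vec p' r'"
      using system_elem_vec[OF x] system_elem_vec[OF y] by metis
    then show ?thesis using c by (simp only: pairing_def f_vec form_vec) simp
  qed
  moreover have "f ` ?\<Psi> = ?X"
    unfolding system_def linear_image_symmetrize[OF lin] image_Un image_image
      short_root_vec long_root_vec f_vec by (simp add: mult.commute)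
  ultimately show ?thesis
    unfolding root_isomorphic_def using lin
    by (intro exI[of _ f]) (auto simp: linear_add linear_scale)
qed

text \<open>No two roots are orthogonal, since their \<open>\<epsilon>\<^sub>1\<close>-coordinates do not vanish.\<close>

lemma irreducible_system:
  assumes "S \<union> L \<noteq> {}"
  shows "irreducible_roots form (system S L)"
proof -
  have "form x y \<noteq> 0" if x: "x \<in> system S L" and y: "y \<in> system S L" for x y
  proof -
    obtain p t p' t' where "x = vec p t" "y = vec p' t'" "p \<noteq> 0" "p' \<noteq> 0"
      using system_elem_vec[OF x] system_elem_vec[OF y] by metis
    then show ?thesis by (simp only: form_vec) simp
  qed
  moreover have "system S L \<noteq> {}" using assms by (auto simp: system_def symmetrize_def)
  ultimately show ?thesis unfolding irreducible_roots_def by blast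
qed

text \<open>The shear with \<open>c = 1\<close> and \<open>u = 1/q\<close> shrinks the step \<open>q\<close> of the short roots to \<open>1\<close>; the value
  of \<open>t\<close> is the one sending \<open>short_root k\<close> to \<open>short_root 0\<close>. The long roots then land on
  \<open>long_root (r + 1)\<close>, an index shift that disappears when \<open>r\<close> runs over all integers.\<close>

lemma type_A2_2_Psi_kq:
  assumes "odd q"
  shows "type_A2_2 form e1 d (Psi_kq e1 d k q)"
proof -
  let ?S = "{x. int q dvd x - int k}" and ?L = "{m. int q dvd 2 * m - 2 * int k - 1}"
  define t where "t = 1/2 - (real k + 1/2) / real q"
  have q0: "real q \<noteq> 0" using assms by (auto elim: oddE)
  have "vec 1 (t + 1 / real q * (of_int (int k + r * int q) + 1/2)) = short_root r" for r
    unfolding short_root_vec vec_eq_iff using q0 by (simp add: t_def field_simps)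
  then have S: "(\<lambda>a. vec 1 (t + 1 / real q * (of_int a + 1/2))) ` ?S = range short_root"
    unfolding odd_modulus_classes_eq_range[OF assms] image_image by simp
  have "vec (2 * 1) (2 * t + 1 / real q * (2 * of_int (int k + 1 + int (q div 2) + r * int q)))
      = long_root (r + 1)" for r
    unfolding long_root_vec vec_eq_iff double_long_offset[OF assms]
    using q0 by (simp add: t_def field_simps)
  then have "(\<lambda>m. vec (2 * 1) (2 * t + 1 / real q * (2 * of_int m))) ` ?L
      = range (\<lambda>r. long_root (r + 1))"
    unfolding odd_modulus_classes_eq_range[OF assms] image_image by simp
  also have "\<dots> = long_root ` range (\<lambda>r. r + 1)" by (simp only: image_image)
  also have "range (\<lambda>r::int. r + 1) = UNIV" by (rule surjI[of _ "\<lambda>r. r - 1"]) simp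
  finally have L: "(\<lambda>m. vec (2 * 1) (2 * t + 1 / real q * (2 * of_int m))) ` ?L = range long_root" .
  have "root_isomorphic form (system ?S ?L) form \<Phi>"
    using root_isomorphic_shear[of 1 "1 / real q" ?S ?L t] q0
    unfolding S L roots_A2_2_eq_system system_def[of UNIV UNIV] by simp
  moreover have "int k \<in> ?S" by simp
  then have "?S \<union> ?L \<noteq> {}" by blast
  then have "irreducible_roots form (system ?S ?L)" by (rule irreducible_system)
  ultimately show ?thesis
    unfolding type_A2_2_def Psi_kq_eq_system[OF assms] by simp
qed

lemma roots_A1_1_eq: "roots_A1_1 e1 d = symmetrize (range (\<lambda>r::int. vec 1 (of_int r)))"
proof (intro equalityI subsetI)
  fix x assume "x \<in> roots_A1_1 e1 d"
  then obtain s :: real and r :: int where "s \<in> {1, -1}" "x = vec s (of_int r)"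
    unfolding roots_A1_1_def by blast
  then have "x = vec 1 (of_int r) \<or> x = - vec 1 (of_int (- r))" by auto
  then show "x \<in> symmetrize (range (\<lambda>r::int. vec 1 (of_int r)))"
    unfolding symmetrize_def by blast
next
  fix x assume "x \<in> symmetrize (range (\<lambda>r::int. vec 1 (of_int r)))"
  then obtain r :: int where "x = vec 1 (of_int r) \<or> x = - vec 1 (of_int r)"
    unfolding symmetrize_def by blast
  then have "x = vec 1 (of_int r) \<or> x = vec (-1) (of_int (- r))" by auto
  then show "x \<in> roots_A1_1 e1 d" unfolding roots_A1_1_def by blast
qed

text \<open>The short roots in one parity class have step \<open>2\<delta>\<close>, hence \<open>u = 1/2\<close>; the value of \<open>t\<close> is
  \<open>-1/4\<close> or \<open>-3/4\<close> so that \<open>\<epsilon>\<^sub>1 + (1/2)\<delta>\<close>, respectively \<open>\<epsilon>\<^sub>1 + (3/2)\<delta>\<close>, is sent to \<open>\<epsilon>\<^sub>1\<close>.\<close>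

lemma type_A1_1_Psi_short:
  "type_A1_1 form e1 d (Psi_short e1 d (1/2))" "type_A1_1 form e1 d (Psi_short e1 d (3/2))"
proof -
  have even: "{a::int. even a} = range (\<lambda>r. 2 * r)"
    and odd: "{a::int. odd a} = range (\<lambda>r. 2 * r + 1)"
    by (auto elim: evenE oddE)
  have "root_isomorphic form (system {a. even a} {}) form (roots_A1_1 e1 d)"
    using root_isomorphic_shear[of 1 "1/2" "{a. even a}" "{}" "- 1/4"]
    unfolding roots_A1_1_eq even image_image by (simp add: algebra_simps)
  moreover have "root_isomorphic form (system {a. odd a} {}) form (roots_A1_1 e1 d)"
    using root_isomorphic_shear[of 1 "1/2" "{a. odd a}" "{}" "- 3/4"]
    unfolding roots_A1_1_eq odd image_image by (simp add: algebra_simps)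
  moreover have "irreducible_roots form (system {a. even a} {})"
    "irreducible_roots form (system {a. odd a} {})"
    using even odd by (auto intro!: irreducible_system)
  ultimately show "type_A1_1 form e1 d (Psi_short e1 d (1/2))"
    "type_A1_1 form e1 d (Psi_short e1 d (3/2))"
    by (simp_all add: type_A1_1_def Psi_short_eq_system)
qed

lemma type_A1_1_Psi_long: "type_A1_1 form e1 d (Psi_long e1 d)"
  using root_isomorphic_shear[of "1/2" "1/2" "{}" UNIV 0] irreducible_system[of "{}" UNIV]
  by (simp add: type_A1_1_def Psi_long_eq_system roots_A1_1_eq)

section \<open>Classification\<close>

lemma maximal_system_cases:
  assumes max: "maximal_closed_subroot_system form \<Phi> \<Psi>"
  shows "(\<exists>k q. prime q \<and> odd q \<and> \<Psi> = Psi_kq e1 d k q) \<or>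
    \<Psi> = Psi_short e1 d (1/2) \<or> \<Psi> = Psi_short e1 d (3/2) \<or> \<Psi> = Psi_long e1 d"
proof -
  have "closed_subroot_system form \<Phi> \<Psi>"
    using max unfolding maximal_closed_subroot_system_def by (rule conjunct1)
  then obtain S L where \<Psi>: "\<Psi> = system S L"
    by (rule closed_subroot_system_eq_system[THEN that])
  have cp: "closed_pair S L"
    using max unfolding \<Psi> maximal_closed_subroot_system_def closed_subroot_system_iff by blast
  have "system S L \<noteq> \<Phi>"
    using max unfolding \<Psi> maximal_closed_subroot_system_def by blast
  then have proper: "\<not> (S = UNIV \<and> L = UNIV)"
    unfolding roots_A2_2_eq_system by blast
  \<comment> \<open>Maximality: a closed pair that contains \<open>(S, L)\<close> and is not everything equals \<open>(S, L)\<close>.\<close>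
  have eqI: "S = S' \<and> L = L'"
    if "closed_pair S' L'" "S \<subseteq> S'" "L \<subseteq> L'" "S' \<noteq> UNIV \<or> L' \<noteq> UNIV" for S' L'
  proof -
    have "closed_subroot_system form \<Phi> (system S' L')"
      using that(1) by (simp add: closed_subroot_system_iff)
    moreover have "system S L \<subseteq> system S' L'" using that by (simp add: system_mono_iff)
    moreover have "system S' L' \<subset> \<Phi>"
      using that(4) unfolding roots_A2_2_eq_system psubset_eq system_mono_iff system_eq_iff by auto
    ultimately have "system S' L' = system S L"
      using max unfolding \<Psi> maximal_closed_subroot_system_def by blast
    then show ?thesis by (simp add: system_eq_iff)
  qed
  consider "L = {}" | "S = {}" | "S \<noteq> {}" "L \<noteq> {}" by blast
  then show ?thesis
  proof cases
    case 1
    have par: "even (a + b)" if "a \<in> S" "b \<in> S" for a b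
    proof (rule ccontr)
      assume "odd (a + b)"
      then have "2 * ((a + b + 1) div 2) = a + b + 1" by presburger
      then show False using cp that 1 unfolding closed_pair_def by blast
    qed
    obtain c where "c \<in> S" using cp 1 unfolding closed_pair_def by blast
    have "S \<subseteq> {a. even (a - c)}"
    proof
      fix a assume "a \<in> S"
      then have "even (a + c)" using par \<open>c \<in> S\<close> by blast
      then show "a \<in> {a. even (a - c)}" by simp
    qed
    then have "S = {a. even (a - c)}"
      using eqI[OF closed_pair_parity[of c]] 1 by simp
    then have "S = {a. even a} \<or> S = {a. odd a}" by (cases "even c") simp_all
    then show ?thesis unfolding \<Psi> Psi_short_eq_system 1 by blast
  next
    case 2
    have "closed_pair {} UNIV" by (simp add: closed_pair_def)
    then have "L = UNIV" using eqI[of "{}" UNIV] 2 by simp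
    then show ?thesis unfolding \<Psi> Psi_long_eq_system 2 by blast
  next
    case 3
    then obtain n a where n: "n \<ge> 0" "odd n"
      and SL: "S = {x. n dvd x - a}" "L = {m. n dvd 2 * m - 2 * a - 1}"
      using closed_pair_both_nonempty[OF cp] by metis
    have "n \<noteq> 1" using proper SL by auto
    then have "nat n \<noteq> 1" using n by simp
    then obtain q where q: "prime q" "q dvd nat n" using prime_factor_nat by blast
    then have qn: "int q dvd n" using n int_dvd_int_iff[of q "nat n"] by simp
    then have "odd (int q)" using n(2) dvd_trans by blast
    then have odd: "odd q" by simp
    \<comment> \<open>Only the class of \<open>a\<close> modulo \<open>q\<close> matters, so the offset can be taken non-negative.\<close>
    define k where "k = nat (a mod int q)"
    have "q > 0" using q(1) by (rule prime_gt_0_nat)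
    then have k: "int q dvd a - int k" by (simp add: k_def mod_eq_dvd_iff[symmetric])
    let ?S = "{x. int q dvd x - int k}" and ?L = "{m. int q dvd 2 * m - 2 * int k - 1}"
    have "S \<subseteq> ?S"
    proof
      fix x assume "x \<in> S"
      then have "int q dvd x - a" using dvd_trans[OF qn] by (simp add: SL)
      from dvd_add[OF this k] show "x \<in> ?S" by simp
    qed
    moreover have "L \<subseteq> ?L"
    proof
      fix m assume "m \<in> L"
      then have "int q dvd 2 * m - 2 * a - 1" using dvd_trans[OF qn] by (simp add: SL)
      from dvd_add[OF this dvd_mult[OF k, of 2]] show "m \<in> ?L" by (simp add: algebra_simps)
    qed
    moreover have "?S \<noteq> UNIV"
    proof
      assume "?S = UNIV"
      then have "int k + 1 \<in> ?S" by (rule ssubst) (rule UNIV_I)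
      then have "q = 1" by simp
      then show False using q(1) by simp
    qed
    ultimately have "S = ?S \<and> L = ?L" using eqI[OF closed_pair_congruence[of "int q" "int k"]] by blast
    then have "\<Psi> = Psi_kq e1 d k q" unfolding \<Psi> Psi_kq_eq_system[OF odd] by simp
    then show ?thesis using q odd by blast
  qed
qed

text \<open>The gradients distinguish the three families, so a system of short or of long roots is never one
  of the \<open>Psi_kq\<close>, and its type is not claimed twice.\<close>

lemma gradient_Psi_kq:
  assumes "odd q"
  shows "gradient e1 d (Psi_kq e1 d k q) = {e1, - e1, 2 *\<^sub>R e1, - (2 *\<^sub>R e1)}"
proof -
  have "range (\<lambda>r. k + r * int q) \<noteq> {}" "range (\<lambda>r. k + 1 + int (q div 2) + r * int q) \<noteq> {}" for k
    by blast+
  then show ?thesis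
    unfolding Psi_kq_eq_system[OF assms] odd_modulus_classes_eq_range[OF assms] gradient_system
    by auto
qed

lemma gradient_Psi_short:
  "gradient e1 d (Psi_short e1 d (1/2)) = {e1, - e1}"
  "gradient e1 d (Psi_short e1 d (3/2)) = {e1, - e1}"
proof -
  have "(0::int) \<in> {a. even a}" "(1::int) \<in> {a. odd a}" by simp_all
  then have "{a::int. even a} \<noteq> {}" "{a::int. odd a} \<noteq> {}" by blast+
  then show "gradient e1 d (Psi_short e1 d (1/2)) = {e1, - e1}"
    "gradient e1 d (Psi_short e1 d (3/2)) = {e1, - e1}"
    unfolding Psi_short_eq_system gradient_system by auto
qed

lemma gradient_Psi_long: "gradient e1 d (Psi_long e1 d) = {2 *\<^sub>R e1, - (2 *\<^sub>R e1)}"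
  by (simp add: Psi_long_eq_system gradient_system)

end

theorem theorem11p1p1:
  fixes form :: "'v::real_vector \<Rightarrow> 'v \<Rightarrow> real"
    and e1 d :: 'v
    and \<Psi> :: "'v set"
  assumes "bilinear form"
    and "\<And>x y. form x y = form y x"
    and "form e1 e1 = 1"
    and "\<And>x. form d x = 0"
    and "e1 \<noteq> d" and "independent {e1, d}"
    and "maximal_closed_subroot_system form (roots_A2_2 e1 d) \<Psi>"
  shows "((gradient e1 d \<Psi> = {e1, - e1, 2 *\<^sub>R e1, - (2 *\<^sub>R e1)} \<and>
            (\<exists>(k::nat) (q::nat). prime q \<and> odd q \<and> \<Psi> = Psi_kq e1 d k q)) \<or>
          (gradient e1 d \<Psi> = {e1, - e1} \<and>
            (\<Psi> = Psi_short e1 d (1/2) \<or> \<Psi> = Psi_short e1 d (3/2))) \<or>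
          (gradient e1 d \<Psi> = {2 *\<^sub>R e1, - (2 *\<^sub>R e1)} \<and> \<Psi> = Psi_long e1 d)) \<and>
         ((\<exists>(k::nat) (q::nat). prime q \<and> odd q \<and> \<Psi> = Psi_kq e1 d k q)
            \<longrightarrow> type_A2_2 form e1 d \<Psi>) \<and>
         (\<not> (\<exists>(k::nat) (q::nat). prime q \<and> odd q \<and> \<Psi> = Psi_kq e1 d k q)
            \<longrightarrow> type_A1_1 form e1 d \<Psi>)"
proof -
  have "d \<noteq> 0" using dependent_zero[of "{e1, d}"] assms(6) by auto
  then interpret degenerate_plane form e1 d
    using assms by unfold_locales
  show ?thesis
    using maximal_system_cases[OF assms(7)] gradient_Psi_kq gradient_Psi_short gradient_Psi_long
      type_A2_2_Psi_kq type_A1_1_Psi_short type_A1_1_Psi_long by metis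
qed

end
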